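(* Let $K\subset\mathbb{R}^n$ be a nontrivial closed convex pointed cone, and suppose $0\notin\operatorname{cl}\operatorname{aff}(E_K)$. Set $d:=-P_{\operatorname{cl}\operatorname{aff}(E_K)}(0)$. Then $d\ne0$, $\langle d,u\rangle=-\|d\|^2$ for every $u\in E_K$, and $d+v\in K^\circ$ for every $v\in\mathbb{R}^n$ with $\|v\|\le\|d\|^2$.
   Context: $\langle\cdot,\cdot\rangle$ and $\|\cdot\|$ are the Euclidean inner product and norm on $\mathbb{R}^n$. Nontrivial means $K\ne\{0\}$; pointed means $K\cap(-K)=\{0\}$. The extremal section of $K$ is $E_K:=\{u\in\mathbb{R}^n:\|u\|=1,\ \mathbb{R}_+u\text{ is an extreme ray of }K\}$. The polar cone is $K^\circ=\{w\in\mathbb{R}^n:\langle w,z\rangle\le0\ \text{for all }z\in K\}$. $\operatorname{cl}\operatorname{aff}(E_K)$ is the closure of the affine hull of $E_K$ and $P_A$ denotes orthogonal projection onto a nonempty closed affine set $A$. *)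

theory Defs
  imports "HOL-Analysis.Analysis"
begin

definition pointed :: "'a::real_vector set \<Rightarrow> bool"
  where "pointed K \<longleftrightarrow> K \<inter> uminus ` K = {0}"

definition ray :: "'a::real_vector \<Rightarrow> 'a set"
  where "ray u = {t *\<^sub>R u | t. 0 \<le> t}"

text \<open>The degenerate ray {0}, which is a face of every pointed cone, is not an extreme ray.\<close>
definition extreme_ray_of :: "'a::real_vector set \<Rightarrow> 'a set \<Rightarrow> bool"  (infixr \<open>(extreme'_ray'_of)\<close> 50)
  where "R extreme_ray_of K \<longleftrightarrow> (\<exists>u. u \<noteq> 0 \<and> R = ray u) \<and> R face_of K"

definition extremal_section :: "'a::real_normed_vector set \<Rightarrow> 'a set"
  where "extremal_section K = {u. norm u = 1 \<and> ray u extreme_ray_of K}"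

definition polar_cone :: "'a::real_inner set \<Rightarrow> 'a set"
  where "polar_cone K = {w. \<forall>z\<in>K. w \<bullet> z \<le> 0}"

end

theory Submission
  imports Defs
begin

text \<open>
  A closed pointed cone K has a compact base B, cut out by a hyperplane.  By Minkowski's theorem B is the
  convex hull of its extreme points, and these span extreme rays of K; hence a half-space through 0
  contains K as soon as it contains the extremal section.  Since d is normal to the affine hull of
  the extremal section, d \<bullet> u = -(norm d)^2 for its members u, while v \<bullet> u \<le> norm v by Cauchy-Schwarz.
\<close>

text \<open>If a convex combination of \<open>x\<close> and \<open>y\<close> vanished,
  \<open>s *\<^sub>R x\<close> would lie in both \<open>K\<close> and its negative, so both summands
  would be 0, against \<open>s + t = 1\<close>. This keeps 0 out of the convex hull of the unit
  vectors of \<open>K\<close>.\<close>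

lemma convex_cone_pointed_minus_zero:
  assumes "convex_cone K" "pointed K"
  shows "convex (K - {0})"
proof (rule convexI)
  fix x y :: 'a and s t :: real
  assume x: "x \<in> K - {0}" and y: "y \<in> K - {0}" and st: "0 \<le> s" "0 \<le> t" "s + t = 1"
  have K: "s *\<^sub>R x \<in> K" "t *\<^sub>R y \<in> K"
    using x y st assms(1) by (auto intro: convex_cone_scaleR)
  have "s *\<^sub>R x + t *\<^sub>R y \<noteq> 0"
  proof
    assume "s *\<^sub>R x + t *\<^sub>R y = 0"
    then have eq: "s *\<^sub>R x = - (t *\<^sub>R y)" by (simp add: eq_neg_iff_add_eq_0)
    with K have "s *\<^sub>R x \<in> K \<inter> uminus ` K" by auto
    then have "s *\<^sub>R x = 0" using assms(2) unfolding pointed_def by blast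
    with eq x y st show False by auto
  qed
  then show "s *\<^sub>R x + t *\<^sub>R y \<in> K - {0}"
    using K assms(1) by (auto intro: convex_cone_add)
qed

text \<open>The unit vectors of \<open>K\<close> form a compact set, so their convex hull is compact
  too; it misses 0 and is strictly separated from it. Homogeneity extends the bound to all of
  \<open>K\<close>. The factor \<open>norm z\<close> is what makes the slice
  \<open>w \<bullet> z = 1\<close> bounded, beyond mere positivity of \<open>w\<close>.\<close>

lemma closed_pointed_cone_base_functional:
  fixes K :: "'a::euclidean_space set"
  assumes "convex_cone K" "closed K" "pointed K"
  obtains w c where "c > 0" "\<And>z. z \<in> K \<Longrightarrow> c * norm z \<le> w \<bullet> z"
proof -
  let ?S = "K \<inter> sphere 0 1"
  have "convex hull ?S \<subseteq> K - {0}"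
    by (rule hull_minimal) (use convex_cone_pointed_minus_zero assms in auto)
  moreover have "closed (convex hull ?S)"
    by (simp add: compact_imp_closed compact_convex_hull closed_Int_compact assms(2))
  ultimately obtain w c where c: "c > 0" and w: "\<forall>x\<in>convex hull ?S. w \<bullet> x > c"
    using separating_hyperplane_closed_0[of "convex hull ?S"] by auto
  have "c * norm z \<le> w \<bullet> z" if "z \<in> K" for z
  proof (cases "z = 0")
    case False
    have "(1 / norm z) *\<^sub>R z \<in> ?S"
      using that False assms(1) by (auto intro: convex_cone_scaleR)
    then have "c < w \<bullet> ((1 / norm z) *\<^sub>R z)" by (intro w[rule_format] hull_inc)
    with False show ?thesis by (simp add: field_simps)
  qed simp
  with c that show thesis by blast
qed

text \<open>If a point of the ray lies between \<open>a\<close> and \<open>b\<close> in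
  \<open>K\<close>, rescaling all three to the slice \<open>w \<bullet> z = 1\<close> puts
  \<open>x\<close> between the rescaled endpoints, and extremality makes both equal to
  \<open>x\<close>.\<close>

lemma extreme_point_of_base_imp_extreme_ray:
  fixes K :: "'a::real_inner set"
  assumes K: "convex_cone K" and w: "\<And>z. z \<in> K \<Longrightarrow> z \<noteq> 0 \<Longrightarrow> w \<bullet> z > 0"
    and x: "x extreme_point_of {z \<in> K. w \<bullet> z = 1}"
  shows "ray x extreme_ray_of K"
proof -
  have xK: "x \<in> K" and wx: "w \<bullet> x = 1" using x by (auto simp: extreme_point_of_def)
  have "ray x face_of K"
    unfolding face_of_def
  proof (intro conjI ballI impI)
    show "ray x \<subseteq> K" using K xK by (auto simp: ray_def intro: convex_cone_scaleR)
    show "convex (ray x)"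
    proof (rule convexI)
      fix y z :: 'a and s t :: real
      assume yz: "y \<in> ray x" "z \<in> ray x" and st: "0 \<le> s" "0 \<le> t"
      then obtain p q where "y = p *\<^sub>R x" "z = q *\<^sub>R x" "0 \<le> p" "0 \<le> q"
        by (auto simp: ray_def)
      with st have "s *\<^sub>R y + t *\<^sub>R z = (s * p + t * q) *\<^sub>R x" "0 \<le> s * p + t * q"
        by (auto simp: scaleR_add_left)
      then show "s *\<^sub>R y + t *\<^sub>R z \<in> ray x" unfolding ray_def by blast
    qed
    fix a b y
    assume a: "a \<in> K" and b: "b \<in> K" and "y \<in> ray x" and "y \<in> open_segment a b"
    then obtain t u where y: "y = t *\<^sub>R x" and u: "0 < u" "u < 1" and ab: "a \<noteq> b"
      and yab: "t *\<^sub>R x = (1 - u) *\<^sub>R a + u *\<^sub>R b"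
      by (auto simp: ray_def in_segment)
    have t: "t = (1 - u) * (w \<bullet> a) + u * (w \<bullet> b)"
      using arg_cong[OF yab, of "inner w"] wx by (simp add: inner_add_right)
    have in_ray: "z \<in> ray x" if "z = s *\<^sub>R x" "0 \<le> s" for z s
      using that by (auto simp: ray_def)
    \<comment> \<open>An endpoint at 0 cannot be rescaled to the slice; in that case the other
      endpoint is directly a positive multiple of \<open>x\<close>.\<close>
    consider "a = 0" | "b = 0" | "a \<noteq> 0" "b \<noteq> 0" by blast
    then have "a \<in> ray x \<and> b \<in> ray x"
    proof cases
      case 1
      with ab b w have "t > 0" using u t by simp
      have "b = (1 / u) *\<^sub>R (t *\<^sub>R x)" unfolding yab using 1 u by simp
      with 1 u \<open>t > 0\<close> show ?thesis
        using in_ray[of a 0] in_ray[of b "t / u"] by simp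
    next
      case 2
      with ab a w have "t > 0" using u t by simp
      have "a = (1 / (1 - u)) *\<^sub>R (t *\<^sub>R x)" unfolding yab using 2 u by simp
      with 2 u \<open>t > 0\<close> show ?thesis
        using in_ray[of b 0] in_ray[of a "t / (1 - u)"] by simp
    next
      case 3
      let ?\<alpha> = "w \<bullet> a" and ?\<beta> = "w \<bullet> b"
      have pos: "?\<alpha> > 0" "?\<beta> > 0" using 3 a b w by auto
      have tpos: "t > 0" unfolding t using pos u by (intro add_pos_pos mult_pos_pos) auto
      define a' b' where "a' = (1 / ?\<alpha>) *\<^sub>R a" and "b' = (1 / ?\<beta>) *\<^sub>R b"
      have B: "a' \<in> {z \<in> K. w \<bullet> z = 1}" "b' \<in> {z \<in> K. w \<bullet> z = 1}"
        using a b K pos by (auto simp: a'_def b'_def intro: convex_cone_scaleR)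
      \<comment> \<open>Dividing \<open>yab\<close> by \<open>t\<close> and writing
        \<open>a\<close>, \<open>b\<close> as multiples of \<open>a'\<close>, \<open>b'\<close>
        gives \<open>x\<close> with these new weights; they sum to 1 by the formula for
        \<open>t\<close>.\<close>
      define v where "v = u * ?\<beta> / t"
      have v1: "1 - v = (1 - u) * ?\<alpha> / t"
        using tpos t by (simp add: v_def field_simps)
      moreover have "0 < (1 - u) * ?\<alpha> / t" using pos u tpos by simp
      ultimately have "v < 1" by linarith
      with pos u tpos have v: "0 < v" "v < 1" by (simp_all add: v_def)
      have "(1 - v) *\<^sub>R a' + v *\<^sub>R b' = (1 / t) *\<^sub>R ((1 - u) *\<^sub>R a + u *\<^sub>R b)"
        unfolding v1 using pos by (simp add: v_def a'_def b'_def scaleR_add_right)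
      also have "\<dots> = x" using tpos by (simp flip: yab)
      finally have x_eq: "x = (1 - v) *\<^sub>R a' + v *\<^sub>R b'" ..
      have "x \<notin> open_segment a' b'" using x B by (auto simp: extreme_point_of_def)
      with x_eq v have "a' = b'" by (auto simp: in_segment)
      with x_eq have "a' = x" "b' = x" by (auto simp flip: scaleR_add_left)
      moreover have "a = ?\<alpha> *\<^sub>R a'" "b = ?\<beta> *\<^sub>R b'"
        using pos by (auto simp: a'_def b'_def)
      ultimately have "a = ?\<alpha> *\<^sub>R x" "b = ?\<beta> *\<^sub>R x" by simp_all
      with pos in_ray show ?thesis by (meson less_imp_le)
    qed
    then show "a \<in> ray x" "b \<in> ray x" by auto
  qed
  moreover have "x \<noteq> 0" using wx by auto
  ultimately show ?thesis by (auto simp: extreme_ray_of_def)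
qed

lemma ray_scaleR_pos:
  assumes "c > 0"
  shows "ray (c *\<^sub>R u) = ray u"
proof -
  have "\<exists>s. t *\<^sub>R u = s *\<^sub>R c *\<^sub>R u \<and> 0 \<le> s" if "0 \<le> t" for t
    using assms that by (intro exI[of _ "t / c"]) auto
  then show ?thesis using assms by (fastforce simp: ray_def)
qed

lemma extreme_ray_imp_extremal_section:
  assumes "ray x extreme_ray_of K" "x \<noteq> 0"
  shows "(1 / norm x) *\<^sub>R x \<in> extremal_section K"
  using assms by (auto simp: extremal_section_def ray_scaleR_pos)

text \<open>Polarity turns the half-space claim into an equality. One inclusion is antitonicity; the
  other passes from extreme points of the slice \<open>B\<close> to its convex hull, then to
  \<open>K\<close> by scaling.\<close>

proposition polar_cone_extremal_section:
  fixes K :: "'a::euclidean_space set"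
  assumes "convex_cone K" "closed K" "pointed K"
  shows "polar_cone (extremal_section K) = polar_cone K"
proof
  have "extremal_section K \<subseteq> K"
  proof
    fix u assume "u \<in> extremal_section K"
    then have "ray u \<subseteq> K"
      by (auto simp: extremal_section_def extreme_ray_of_def dest: face_of_imp_subset)
    moreover have "u \<in> ray u" unfolding ray_def by (auto intro: exI[of _ 1])
    ultimately show "u \<in> K" by blast
  qed
  then show "polar_cone K \<subseteq> polar_cone (extremal_section K)"
    by (auto simp: polar_cone_def)
  show "polar_cone (extremal_section K) \<subseteq> polar_cone K"
  proof
    fix a assume a: "a \<in> polar_cone (extremal_section K)"
    obtain w c where c: "c > 0" and w: "\<And>z. z \<in> K \<Longrightarrow> c * norm z \<le> w \<bullet> z"
      using closed_pointed_cone_base_functional assms by blast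
    have wpos: "w \<bullet> z > 0" if "z \<in> K" "z \<noteq> 0" for z
      using w[OF that(1)] c that(2) by (smt (verit) mult_pos_pos zero_less_norm_iff)
    define B where "B = {z \<in> K. w \<bullet> z = 1}"
    have B: "B = K \<inter> {z. w \<bullet> z = 1}" by (auto simp: B_def)
    have "convex B"
      unfolding B using assms(1) by (intro convex_Int convex_hyperplane) (simp add: convex_cone_def)
    moreover have "compact B"
    proof -
      \<comment> \<open>On \<open>B\<close> the estimate for \<open>w\<close> reads
        \<open>c * norm z \<le> 1\<close>.\<close>
      have "norm z \<le> 1 / c" if "z \<in> B" for z
        using w[of z] c that by (simp add: B_def field_simps)
      then have "bounded B" by (auto simp: bounded_iff)
      moreover have "closed B" unfolding B by (intro closed_Int assms closed_hyperplane)
      ultimately show ?thesis by (simp add: compact_eq_bounded_closed)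
    qed
    ultimately have KM: "B = convex hull {x. x extreme_point_of B}"
      by (intro Krein_Milman_Minkowski)
    have ext: "a \<bullet> x \<le> 0" if "x extreme_point_of B" for x
    proof -
      have "x \<noteq> 0" using that by (auto simp: extreme_point_of_def B_def)
      moreover have "ray x extreme_ray_of K"
        using extreme_point_of_base_imp_extreme_ray assms(1) wpos that unfolding B_def by blast
      ultimately have "a \<bullet> ((1 / norm x) *\<^sub>R x) \<le> 0"
        using a extreme_ray_imp_extremal_section unfolding polar_cone_def by blast
      with \<open>x \<noteq> 0\<close> show ?thesis by (simp add: divide_le_0_iff)
    qed
    have "convex hull {x. x extreme_point_of B} \<subseteq> {z. a \<bullet> z \<le> 0}"
      by (rule hull_minimal) (use ext convex_halfspace_le in auto)
    with KM have le: "a \<bullet> z \<le> 0" if "z \<in> B" for z using that by auto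
    have "a \<bullet> z \<le> 0" if "z \<in> K" for z
    proof (cases "z = 0")
      case False
      then have "w \<bullet> z > 0" using wpos that by blast
      moreover from this have "(1 / (w \<bullet> z)) *\<^sub>R z \<in> B"
        using that assms(1) by (auto simp: B_def intro: convex_cone_scaleR)
      then have "a \<bullet> ((1 / (w \<bullet> z)) *\<^sub>R z) \<le> 0" by (rule le)
      ultimately show ?thesis by (simp add: divide_le_0_iff)
    qed simp
    then show "a \<in> polar_cone K" by (simp add: polar_cone_def)
  qed
qed

text \<open>The variational inequality for the projection p holds at \<open>x\<close> and, since
  \<open>S\<close> is affine, also at the reflected point 2p - x. The two inequalities have opposite
  signs, which forces equality.\<close>

lemma affine_closest_point_orthogonal:
  fixes S :: "'a::euclidean_space set"
  assumes "affine S" "x \<in> S"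
  shows "(a - closest_point S a) \<bullet> (x - closest_point S a) = 0"
proof -
  let ?p = "closest_point S a"
  have S: "convex S" "closed S" using assms affine_imp_convex affine_closed by blast+
  have p: "?p \<in> S" using S assms by (intro closest_point_in_set) auto
  have reflection: "2 *\<^sub>R ?p + (-1) *\<^sub>R x \<in> S" using mem_affine[OF assms(1) p assms(2), of 2 "-1"] by simp
  have "(a - ?p) \<bullet> (?p - x) \<le> 0"
    using closest_point_dot[OF S reflection, of a] by (simp add: scaleR_2)
  moreover have "(a - ?p) \<bullet> (x - ?p) \<le> 0" using closest_point_dot[OF S assms(2)] .
  ultimately show ?thesis by (simp add: inner_diff_right)
qed

theorem theorem6p3:
  fixes K :: "(real ^ 'n) set" and d :: "real ^ 'n"
  assumes "convex_cone K" and "closed K" and "pointed K" and "K \<noteq> {0}"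
    and "0 \<notin> closure (affine hull (extremal_section K))"
    and "d = - closest_point (closure (affine hull (extremal_section K))) 0"
  shows "d \<noteq> 0 \<and>
    (\<forall>u \<in> extremal_section K. d \<bullet> u = - (norm d)\<^sup>2) \<and>
    (\<forall>v :: real ^ 'n. norm v \<le> (norm d)\<^sup>2 \<longrightarrow> d + v \<in> polar_cone K)"
proof (intro conjI ballI allI impI)
  let ?E = "extremal_section K"
  let ?A = "affine hull ?E"
  \<comment> \<open>In finite dimension affine hulls are closed, so the closure disappears.\<close>
  have d: "d = - closest_point ?A 0" and A0: "0 \<notin> ?A" using assms(5,6) by simp_all
  note polar = polar_cone_extremal_section[OF assms(1-3)]
  \<comment> \<open>Nonemptiness is what puts \<open>closest_point ?A 0\<close> in
    \<open>?A\<close>. An empty \<open>?E\<close> has the whole space as polar, so each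
    \<open>z\<close> in \<open>K\<close> could be tested against itself and would be 0.\<close>
  have "?E \<noteq> {}"
  proof
    assume "?E = {}"
    with polar have "polar_cone K = UNIV" by (simp add: polar_cone_def)
    then have "\<forall>z\<in>K. z \<bullet> z \<le> 0" unfolding polar_cone_def by blast
    then have "K \<subseteq> {0}" by (auto simp flip: power2_norm_eq_inner)
    with assms(1,4) show False by (auto dest: convex_cone_nonempty)
  qed
  then have "closest_point ?A 0 \<in> ?A" by (intro closest_point_in_set) auto
  with A0 d show "d \<noteq> 0" by auto
  \<comment> \<open>With projected point 0 and closest point \<open>- d\<close>, orthogonality reads
    \<open>d \<bullet> (u + d) = 0\<close>.\<close>
  show E: "d \<bullet> u = - (norm d)\<^sup>2" if "u \<in> ?E" for u
    using affine_closest_point_orthogonal[OF affine_affine_hull hull_inc[OF that], of 0]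
    by (simp add: d power2_norm_eq_inner inner_diff_right)
  fix v :: "real ^ 'n"
  assume v: "norm v \<le> (norm d)\<^sup>2"
  have "(d + v) \<bullet> u \<le> 0" if "u \<in> ?E" for u
  proof -
    have "v \<bullet> u \<le> norm v"
      using norm_cauchy_schwarz[of v u] that by (simp add: extremal_section_def)
    with v E[OF that] show ?thesis by (simp add: inner_add_left)
  qed
  then have "d + v \<in> polar_cone ?E" by (simp add: polar_cone_def)
  with polar show "d + v \<in> polar_cone K" by simp
qed

end
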